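(* Let $s>0$ and let $M^s\in\mathcal{LC}$ be the sequence defined by its quotients $\mu^s_0:=1$ and $\mu^s_p:=\exp\left(s\sum_{l=1}^p\frac1l\right)$ for $p\ge1$ (i.e. $M^s_0=1$, $M^s_p=\prod_{i=1}^p\mu^s_i$). Then there is $C\ge1$ with $C^{-1}p^s\le\mu^s_p\le Cp^s$ for all integers $p\ge1$, hence $M^s$ is equivalent to the Gevrey sequence $G^s=(p!^s)_{p\in\mathbb{N}}$. Moreover, the sequence of integers $$a_j:=c(j+5)^2,\quad j\ge1,\qquad c:=\left\lceil\frac1s\right\rceil,$$ is a sequence of Lusky numbers for $M^s$. In particular, if $s\ge1$, then $a_j:=(j+5)^2$ is a sequence of Lusky numbers for $M^s$.
   Context: $\mathbb{N}=\{0,1,2,\dots\}$. For a sequence $M=(M_p)_{p\in\mathbb{N}}$ of positive reals put $\mu_p:=M_p/M_{p-1}$ for $p\ge1$ and $\mu_0:=1$. $\mathcal{LC}$ is the set of all such $M$ with $M_0=1\le M_1$, $M_p^2\le M_{p-1}M_{p+1}$ for all $p\ge1$, and $\lim_{p\to\infty}(M_p)^{1/p}=+\infty$. $M$ and $N$ are equivalent if $\sup_{p\ge1}(M_p/N_p)^{1/p}<+\infty$ and $\sup_{p\ge1}(N_p/M_p)^{1/p}<+\infty$. $\lceil x\rceil$ is the smallest integer $\ge x$. Here $M^s$ is just a name (the superscript is an index). For integers $0\le k<l$, $$A_M(k,l):=\frac{(\mu_{l+1})^{l-k}}{\mu_{k+1}\cdots\mu_l},\qquad B_M(k,l):=\frac{\mu_{k+1}\cdots\mu_l}{(\mu_{k+1})^{l-k}}.$$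 A strictly increasing sequence of nonnegative integers $(a_j)_{j\ge1}$ is called a sequence of Lusky numbers for $M$ if there exist constants $K\ge b>2$ such that for all $j\ge1$: $b\le\min\{A_M(a_j,a_{j+1}),B_M(a_j,a_{j+1})\}\le\max\{A_M(a_j,a_{j+1}),B_M(a_j,a_{j+1})\}\le K$. *)

theory Defs
  imports Complex_Main
begin

definition quotient_seq :: "(nat \<Rightarrow> real) \<Rightarrow> nat \<Rightarrow> real" where
  "quotient_seq M p = (if p = 0 then 1 else M p / M (p - 1))"

definition LC :: "(nat \<Rightarrow> real) set" where
  "LC = {M. (\<forall>p. M p > 0) \<and> M 0 = 1 \<and> 1 \<le> M 1 \<and>
            (\<forall>p\<ge>1. (M p)\<^sup>2 \<le> M (p - 1) * M (p + 1)) \<and>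
            filterlim (\<lambda>p. M p powr (1 / real p)) at_top sequentially}"

(* Finiteness of the two suprema is expressed as boundedness above. *)
definition equivalent_seq :: "(nat \<Rightarrow> real) \<Rightarrow> (nat \<Rightarrow> real) \<Rightarrow> bool" where
  "equivalent_seq M N \<longleftrightarrow>
     bdd_above ((\<lambda>p. (M p / N p) powr (1 / real p)) ` {1..}) \<and>
     bdd_above ((\<lambda>p. (N p / M p) powr (1 / real p)) ` {1..})"

(* Both expressions are meant for k < l only, where l - k is not truncated. *)
definition Lusky_A :: "(nat \<Rightarrow> real) \<Rightarrow> nat \<Rightarrow> nat \<Rightarrow> real" where
  "Lusky_A M k l = quotient_seq M (l + 1) ^ (l - k) / (\<Prod>i=k+1..l. quotient_seq M i)"

definition Lusky_B :: "(nat \<Rightarrow> real) \<Rightarrow> nat \<Rightarrow> nat \<Rightarrow> real" where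
  "Lusky_B M k l = (\<Prod>i=k+1..l. quotient_seq M i) / quotient_seq M (k + 1) ^ (l - k)"

(* The sequence a is indexed by j \<ge> 1; the value a 0 is irrelevant. *)
definition Lusky_numbers :: "(nat \<Rightarrow> real) \<Rightarrow> (nat \<Rightarrow> nat) \<Rightarrow> bool" where
  "Lusky_numbers M a \<longleftrightarrow>
     strict_mono_on {1..} a \<and>
     (\<exists>b K. K \<ge> b \<and> b > 2 \<and>
        (\<forall>j\<ge>1. b \<le> min (Lusky_A M (a j) (a (j + 1))) (Lusky_B M (a j) (a (j + 1))) \<and>
               max (Lusky_A M (a j) (a (j + 1))) (Lusky_B M (a j) (a (j + 1))) \<le> K))"

(* For p = 0 the sum is empty, so the value is 1. *)
definition mu_s :: "real \<Rightarrow> nat \<Rightarrow> real" where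
  "mu_s s p = exp (s * (\<Sum>l=1..p. 1 / real l))"

definition M_s :: "real \<Rightarrow> nat \<Rightarrow> real" where
  "M_s s p = (\<Prod>i=1..p. mu_s s i)"

definition Gevrey :: "real \<Rightarrow> nat \<Rightarrow> real" where
  "Gevrey s p = fact p powr s"

end

theory Submission
  imports Defs "HOL-Analysis.Harmonic_Numbers"
begin

text \<open>
  The quotients are \<open>exp (s * H p)\<close> with \<open>H p\<close> the \<open>p\<close>-th harmonic number, so after taking
  logarithms every claim is one about harmonic numbers.

  \<^item> From \<open>ln p \<le> H p \<le> ln p + 1\<close> the quotients lie between \<open>p powr s\<close> and
    \<open>exp s * p powr s\<close>. Multiplying these bounds gives \<open>G p \<le> M p \<le> exp s ^ p * G p\<close> for the
    Gevrey sequence \<open>G\<close>, which is equivalence (lemma \<open>bdd_above_root_quotient\<close>).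

  \<^item> Log-convexity is monotonicity of \<open>H\<close>. The growth of the roots comes from the closed form
    \<open>H 1 + ... + H p = (p + 1) * H p - p\<close>: the logarithm of the \<open>p\<close>-th root of \<open>M p\<close> is at
    least \<open>s * (H p - 1)\<close>.

  \<^item> Write \<open>l = k + n\<close>. The logarithms of the two Lusky expressions are \<open>s\<close> times a sum of
    differences of \<open>H\<close> between indices in \<open>{k+1..l+1}\<close>. Each difference \<open>H q - H p\<close> is \<open>q - p\<close>
    up to a factor between \<open>1 / (l+1)\<close> and \<open>1 / k\<close>, and summing the gaps \<open>q - p\<close> gives about
    \<open>n\<^sup>2 / 2\<close>. Hence, as long as \<open>l\<close> is comparable to \<open>k\<close>, both logarithms have the size of
    \<open>s * n\<^sup>2 / (2 * k)\<close>. This is bounded and bounded away from \<open>0\<close> when \<open>n\<close> has the order of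
    the square root of \<open>k\<close>, which is why quadratic sequences appear: for \<open>k = c * J\<^sup>2\<close> and
    \<open>l = c * (J+1)\<^sup>2\<close> it is about \<open>2 * s * c\<close>. The choice of \<open>c\<close> makes \<open>s * c \<ge> 1\<close>, and the
    precise estimates (lemma \<open>quadratic_gap_bounds\<close>) put the logarithms between \<open>s * c\<close> and
    \<open>6 * s * c\<close>. The expressions themselves are therefore at least \<open>exp 1\<close>, which exceeds \<open>2\<close>.
\<close>

section \<open>Harmonic numbers\<close>

lemma harm_le_ln_add_1:
  assumes "p \<ge> 1"
  shows "harm p \<le> ln (real p) + (1::real)"
  using euler_mascheroni_sequence_decreasing[of 1 p] assms by (simp add: harm_expand)

lemma ln_le_harm':
  assumes "p \<ge> 1"
  shows "ln (real p) \<le> harm p"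
proof -
  have "ln (real p) \<le> ln (real p + 1)"
    using assms by simp
  also have "\<dots> \<le> harm p"
    by (rule ln_le_harm)
  finally show ?thesis .
qed

lemma sum_harm: "(\<Sum>i=1..p. harm i) = (real p + 1) * harm p - real p"
proof (induction p)
  case 0
  show ?case by (simp add: harm_expand)
next
  case (Suc p)
  have "(real (Suc p) + 1) * harm (Suc p) - real (Suc p)
      = (real p + 1) * harm p - real p + harm (Suc p)"
    by (simp add: harm_Suc field_simps)
  with Suc.IH show ?case by simp
qed

lemma harm_diff:
  assumes "p \<le> q"
  shows "harm q - harm p = (\<Sum>m=p+1..q. inverse (real m))"
  using assms by (induction q rule: dec_induct) (simp_all add: harm_Suc)

text \<open>
  The difference is a sum of \<open>q - p\<close> reciprocals of numbers in any interval \<open>{a..b}\<close>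
  containing \<open>{p+1..q}\<close>; one interval will serve for many pairs \<open>p, q\<close> at once.
\<close>
lemma harm_diff_bounds:
  assumes "p \<le> q" "0 < a" "a \<le> p + 1" "q \<le> b"
  shows "(real q - real p) / real b \<le> harm q - harm p"
    and "harm q - harm p \<le> (real q - real p) / real a"
proof -
  have "(\<Sum>m=p+1..q. inverse (real b)) \<le> (\<Sum>m=p+1..q. inverse (real m))"
    using assms by (intro sum_mono) (simp add: le_imp_inverse_le)
  then show "(real q - real p) / real b \<le> harm q - harm p"
    using assms by (simp add: harm_diff divide_inverse of_nat_diff)
  have "(\<Sum>m=p+1..q. inverse (real m)) \<le> (\<Sum>m=p+1..q. inverse (real a))"
    using assms by (intro sum_mono) (simp add: le_imp_inverse_le)
  then show "harm q - harm p \<le> (real q - real p) / real a"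
    using assms by (simp add: harm_diff divide_inverse of_nat_diff)
qed

section \<open>The sequence and its quotients\<close>

lemma mu_s_harm: "mu_s s p = exp (s * harm p)"
  by (simp add: mu_s_def harm_def divide_inverse)

lemma mu_s_pos: "mu_s s p > 0"
  by (simp add: mu_s_def)

lemma M_s_pos: "M_s s p > 0"
  by (simp add: M_s_def mu_s_pos prod_pos)

lemma M_s_Suc: "M_s s (Suc p) = M_s s p * mu_s s (Suc p)"
  by (simp add: M_s_def)

lemma M_s_exp: "M_s s p = exp (s * ((real p + 1) * harm p - real p))"
  by (simp add: M_s_def mu_s_harm flip: sum_harm exp_sum sum_distrib_left)

lemma quotient_seq_M_s: "quotient_seq (M_s s) p = mu_s s p"
proof (cases p)
  case 0
  then show ?thesis by (simp add: quotient_seq_def mu_s_def)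
next
  case (Suc q)
  then show ?thesis
    using M_s_pos[of s q] by (simp add: quotient_seq_def M_s_Suc)
qed

lemma mu_s_ge_powr:
  assumes "s > 0" "p \<ge> 1"
  shows "real p powr s \<le> mu_s s p"
  using assms ln_le_harm'[of p] by (simp add: mu_s_harm powr_def)

lemma mu_s_le_powr:
  assumes "s > 0" "p \<ge> 1"
  shows "mu_s s p \<le> exp s * real p powr s"
proof -
  have "s * harm p \<le> s * (ln (real p) + 1)"
    using assms harm_le_ln_add_1[of p] by (intro mult_left_mono) auto
  then show ?thesis
    using assms by (simp add: mu_s_harm powr_def algebra_simps flip: exp_add)
qed

section \<open>Log-convexity and growth of the roots\<close>

lemma filterlim_root_M_s:
  assumes "s > 0"
  shows "filterlim (\<lambda>p. M_s s p powr (1 / real p)) at_top sequentially"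
proof (rule filterlim_at_top_mono)
  have "filterlim (\<lambda>p. s * (-1 + harm p)) at_top sequentially"
    using assms filterlim_tendsto_add_at_top[OF tendsto_const[of "-1"] harm_at_top]
    by (intro filterlim_tendsto_pos_mult_at_top[OF tendsto_const]) auto
  then show "filterlim (\<lambda>p. exp (s * (-1 + harm p))) at_top sequentially"
    by (rule filterlim_compose[OF exp_at_top])
  show "\<forall>\<^sub>F p in sequentially. exp (s * (-1 + harm p)) \<le> M_s s p powr (1 / real p)"
    using eventually_ge_at_top[of 1]
  proof eventually_elim
    case (elim p)
    have "s * (harm p - 1) \<le> s * ((real p + 1) * harm p - real p) / real p"
      using assms elim harm_nonneg[of p, where 'a = real]
      by (simp add: field_simps)
    then show ?case
      by (simp add: M_s_exp powr_def)
  qed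
qed

lemma M_s_log_convex:
  assumes "s > 0" "p \<ge> 1"
  shows "(M_s s p)\<^sup>2 \<le> M_s s (p - 1) * M_s s (p + 1)"
proof -
  obtain q where q: "p = Suc q"
    using assms(2) by (cases p) auto
  have "mu_s s (Suc q) \<le> mu_s s (Suc (Suc q))"
    using assms(1) by (simp add: mu_s_harm harm_mono)
  then have "M_s s q * M_s s p * mu_s s (Suc q) \<le> M_s s q * M_s s p * mu_s s (Suc (Suc q))"
    by (intro mult_left_mono mult_nonneg_nonneg less_imp_le[OF M_s_pos])
  then show ?thesis
    by (simp add: q M_s_Suc power2_eq_square mult_ac)
qed

lemma M_s_in_LC:
  assumes "s > 0"
  shows "M_s s \<in> LC"
proof -
  have "1 \<le> M_s s 1"
    using assms by (simp add: M_s_def mu_s_def)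
  moreover have "M_s s 0 = 1"
    by (simp add: M_s_def)
  ultimately show ?thesis
    unfolding LC_def using assms M_s_pos M_s_log_convex filterlim_root_M_s by blast
qed

section \<open>Equivalence with the Gevrey sequence\<close>

lemma bdd_above_root_quotient:
  fixes M N :: "nat \<Rightarrow> real"
  assumes "\<And>p. M p > 0" "\<And>p. N p > 0" "C > 0" "\<And>p. M p \<le> C ^ p * N p"
  shows "bdd_above ((\<lambda>p. (M p / N p) powr (1 / real p)) ` {1..})"
proof (rule bdd_aboveI2)
  fix p :: nat
  assume "p \<in> {1..}"
  then have p: "p \<ge> 1" by simp
  have "(M p / N p) powr (1 / real p) \<le> (C ^ p) powr (1 / real p)"
    using assms(1-2)[of p] assms(4)[of p] by (intro powr_mono2) (auto simp: divide_simps)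
  also have "\<dots> = C"
    using p assms(3) by (simp add: powr_powr flip: powr_realpow)
  finally show "(M p / N p) powr (1 / real p) \<le> C" .
qed

lemma Gevrey_prod: "Gevrey s p = (\<Prod>i=1..p. real i powr s)"
  by (simp add: Gevrey_def fact_prod prod_powr_distrib)

lemma Gevrey_le_M_s:
  assumes "s > 0"
  shows "Gevrey s p \<le> M_s s p"
  unfolding Gevrey_prod M_s_def using assms by (intro prod_mono) (auto intro: mu_s_ge_powr)

lemma M_s_le_Gevrey:
  assumes "s > 0"
  shows "M_s s p \<le> exp s ^ p * Gevrey s p"
proof -
  have "M_s s p \<le> (\<Prod>i=1..p. exp s * real i powr s)"
    unfolding M_s_def using assms
    by (intro prod_mono) (auto intro: mu_s_le_powr less_imp_le[OF mu_s_pos])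
  then show ?thesis
    by (simp add: Gevrey_prod prod.distrib)
qed

lemma equivalent_M_s_Gevrey:
  assumes "s > 0"
  shows "equivalent_seq (M_s s) (Gevrey s)"
proof -
  have "Gevrey s p > 0" for p
    by (simp add: Gevrey_def)
  then show ?thesis
    unfolding equivalent_seq_def
    using bdd_above_root_quotient[of "M_s s" "Gevrey s" "exp s"]
      bdd_above_root_quotient[of "Gevrey s" "M_s s" 1]
      M_s_pos Gevrey_le_M_s[OF assms] M_s_le_Gevrey[OF assms]
    by simp
qed

section \<open>Lusky numbers\<close>

lemma Lusky_A_M_s:
  "Lusky_A (M_s s) k (k + n) = exp (s * (\<Sum>i=k+1..k+n. harm (k + n + 1) - harm i))"
  by (simp add: Lusky_A_def quotient_seq_M_s mu_s_harm sum_subtractf sum_distrib_left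
      exp_diff right_diff_distrib mult.left_commute flip: exp_sum exp_of_nat_mult)

lemma Lusky_B_M_s:
  "Lusky_B (M_s s) k (k + n) = exp (s * (\<Sum>i=k+1..k+n. harm i - harm (k + 1)))"
  by (simp add: Lusky_B_def quotient_seq_M_s mu_s_harm sum_subtractf sum_distrib_left
      exp_diff right_diff_distrib mult.left_commute flip: exp_sum exp_of_nat_mult)

lemma sum_shifted: "(\<Sum>i=k+1..k+n. real i) = real n * real k + real n * (real n + 1) / 2"
  by (induction n) (simp_all add: field_simps)

text \<open>
  The gaps between the indices of the harmonic numbers are \<open>n, ..., 1\<close> for the first expression
  and \<open>0, ..., n-1\<close> for the second one; the bounds are chosen wide enough to cover both.
\<close>
lemma Lusky_M_s_bounds:
  fixes s :: real and k n :: nat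
  assumes "s > 0" "k > 0"
  defines "L \<equiv> s * (real n * (real n - 1) / (2 * real (k + n + 1)))"
    and "U \<equiv> s * (real n * (real n + 1) / (2 * real k))"
  shows "Lusky_A (M_s s) k (k + n) \<in> {exp L..exp U}"
    and "Lusky_B (M_s s) k (k + n) \<in> {exp L..exp U}"
proof -
  define b where "b = k + n + 1"
  have b: "b > 0" by (simp add: b_def)
  let ?I = "{k+1..k+n}"
  let ?gA = "\<lambda>i. real (k + n + 1) - real i"
  let ?gB = "\<lambda>i. real i - real (k + 1)"
  have gA: "sum ?gA ?I = real n * (real n + 1) / 2"
    unfolding sum_subtractf sum_shifted by (simp add: field_simps)
  have gB: "sum ?gB ?I = real n * (real n - 1) / 2"
    unfolding sum_subtractf sum_shifted by (simp add: field_simps)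
  have widen: "real n * (real n - 1) / 2 \<le> real n * (real n + 1) / 2"
    by (simp add: mult_left_mono)
  have A1: "(\<Sum>i\<in>?I. ?gA i / real b) \<le> (\<Sum>i\<in>?I. harm (k + n + 1) - harm i)"
    by (intro sum_mono harm_diff_bounds[where a = k]) (use assms in \<open>auto simp: b_def\<close>)
  have A2: "(\<Sum>i\<in>?I. harm (k + n + 1) - harm i) \<le> (\<Sum>i\<in>?I. ?gA i / real k)"
    by (intro sum_mono harm_diff_bounds[where b = b]) (use assms in \<open>auto simp: b_def\<close>)
  have B1: "(\<Sum>i\<in>?I. ?gB i / real b) \<le> (\<Sum>i\<in>?I. harm i - harm (k + 1))"
    by (intro sum_mono harm_diff_bounds[where a = k]) (use assms in \<open>auto simp: b_def\<close>)
  have B2: "(\<Sum>i\<in>?I. harm i - harm (k + 1)) \<le> (\<Sum>i\<in>?I. ?gB i / real k)"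
    by (intro sum_mono harm_diff_bounds[where b = b]) (use assms in \<open>auto simp: b_def\<close>)
  note sums = A1 A2 B1 B2
  note sums = sums[unfolded sum_divide_distrib[symmetric] gA gB]
  have wb: "real n * (real n - 1) / 2 / real b \<le> real n * (real n + 1) / 2 / real b"
    and wk: "real n * (real n - 1) / 2 / real k \<le> real n * (real n + 1) / 2 / real k"
    using widen by (simp_all add: divide_right_mono)
  have L: "L = s * (real n * (real n - 1) / 2 / real b)"
    and U: "U = s * (real n * (real n + 1) / 2 / real k)"
    by (simp_all add: L_def U_def b_def)
  show "Lusky_A (M_s s) k (k + n) \<in> {exp L..exp U}"
    unfolding Lusky_A_M_s L U atLeastAtMost_iff exp_le_cancel_iff
    using assms(1) sums wb by (intro conjI mult_left_mono) linarith+
  show "Lusky_B (M_s s) k (k + n) \<in> {exp L..exp U}"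
    unfolding Lusky_B_M_s L U atLeastAtMost_iff exp_le_cancel_iff
    using assms(1) sums wk by (intro conjI mult_left_mono) linarith+
qed

text \<open>
  The interval between consecutive terms \<open>c * J\<^sup>2\<close> and \<open>c * (J+1)\<^sup>2\<close> has length
  \<open>n = c * (2*J+1)\<close>. Because \<open>c \<ge> 1\<close>, the added and subtracted \<open>1\<close> can be replaced by
  \<open>c\<close>; powers of \<open>c\<close> then cancel, and what is left is \<open>J\<^sup>2 \<ge> J + 2\<close> for the lower estimate and
  \<open>(2*J+1) * (J+1) \<le> 6 * J\<^sup>2\<close> for the upper one.
\<close>
lemma quadratic_gap_bounds:
  fixes c J :: real
  assumes "c \<ge> 1" "J \<ge> 2"
  defines "n \<equiv> c * (2 * J + 1)"
  shows "c \<le> n * (n - 1) / (2 * (c * J\<^sup>2 + n + 1))"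
    and "n * (n + 1) / (2 * (c * J\<^sup>2)) \<le> 6 * c"
proof -
  have J: "J + 2 \<le> J\<^sup>2"
    using mult_mono[of 2 J "1" "J - 1"] assms by (simp add: power2_eq_square algebra_simps)
  have n: "n \<ge> 0"
    using assms by (simp add: n_def)
  have pos: "c * J\<^sup>2 > 0"
    using assms by simp
  have "2 * (c * J\<^sup>2 + n + 1) \<le> (2 * J + 1) * (c * (2 * J))"
  proof -
    have "c * (J + 2) \<le> c * J\<^sup>2"
      using J assms by (intro mult_left_mono) auto
    then show ?thesis
      using assms(1) by (simp add: n_def power2_eq_square algebra_simps)
  qed
  also have "\<dots> \<le> (2 * J + 1) * (n - 1)"
    using assms by (intro mult_left_mono) (auto simp: n_def algebra_simps)
  finally have "c * (2 * (c * J\<^sup>2 + n + 1)) \<le> c * ((2 * J + 1) * (n - 1))"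
    using assms by (intro mult_left_mono) auto
  also have "\<dots> = n * (n - 1)"
    by (simp add: n_def)
  finally show "c \<le> n * (n - 1) / (2 * (c * J\<^sup>2 + n + 1))"
    using pos n by (simp add: le_divide_eq)
  have "n * (n + 1) \<le> n * (c * (2 * J + 2))"
    using assms(1) n by (intro mult_left_mono) (auto simp: n_def algebra_simps)
  also have "\<dots> = c * c * ((2 * J + 1) * (2 * J + 2))"
    by (simp add: n_def)
  also have "\<dots> \<le> c * c * (12 * J\<^sup>2)"
  proof (intro mult_left_mono)
    show "(2 * J + 1) * (2 * J + 2) \<le> 12 * J\<^sup>2"
      using J assms(2) by (simp add: power2_eq_square algebra_simps)
  qed (use assms in auto)
  also have "\<dots> = 6 * c * (2 * (c * J\<^sup>2))"
    by simp
  finally show "n * (n + 1) / (2 * (c * J\<^sup>2)) \<le> 6 * c"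
    using pos by (simp add: divide_le_eq)
qed

lemma Lusky_numbers_quadratic:
  fixes s :: real and c :: nat
  assumes "s > 0" "c > 0" "s * real c \<ge> 1"
  shows "Lusky_numbers (M_s s) (\<lambda>j. c * (j + 5)\<^sup>2)"
proof -
  have bounds: "exp 1 \<le> Lusky_A (M_s s) (c * (j + 5)\<^sup>2) (c * (j + 1 + 5)\<^sup>2) \<and>
      Lusky_A (M_s s) (c * (j + 5)\<^sup>2) (c * (j + 1 + 5)\<^sup>2) \<le> exp (s * (6 * real c)) \<and>
      exp 1 \<le> Lusky_B (M_s s) (c * (j + 5)\<^sup>2) (c * (j + 1 + 5)\<^sup>2) \<and>
      Lusky_B (M_s s) (c * (j + 5)\<^sup>2) (c * (j + 1 + 5)\<^sup>2) \<le> exp (s * (6 * real c))" for j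
  proof -
    define J where "J = j + 5"
    define k where "k = c * J\<^sup>2"
    define n where "n = c * (2 * J + 1)"
    have next_eq: "c * (j + 1 + 5)\<^sup>2 = k + n"
      by (simp add: k_def n_def J_def power2_eq_square algebra_simps)
    have k: "k > 0"
      using assms by (simp add: k_def J_def)
    have kn: "real k = real c * (real J)\<^sup>2" "real n = real c * (2 * real J + 1)"
      by (simp_all add: k_def n_def algebra_simps)
    have gap: "real c \<le> real n * (real n - 1) / (2 * real (k + n + 1))"
      "real n * (real n + 1) / (2 * real k) \<le> 6 * real c"
      unfolding of_nat_add of_nat_1 kn
      by (rule quadratic_gap_bounds; use assms(2) in \<open>simp add: J_def\<close>)+
    have "s * real c \<le> s * (real n * (real n - 1) / (2 * real (k + n + 1)))"
      by (intro mult_left_mono gap) (use assms in simp)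
    with assms(3) have L: "exp 1 \<le> exp (s * (real n * (real n - 1) / (2 * real (k + n + 1))))"
      unfolding exp_le_cancel_iff by linarith
    have U: "exp (s * (real n * (real n + 1) / (2 * real k))) \<le> exp (s * (6 * real c))"
      unfolding exp_le_cancel_iff by (intro mult_left_mono gap) (use assms in simp)
    show ?thesis
      unfolding next_eq J_def[symmetric] k_def[symmetric]
      using Lusky_M_s_bounds[OF assms(1) k, of n] L U
      unfolding atLeastAtMost_iff by (meson order_trans)
  qed
  have "strict_mono_on {1..} (\<lambda>j. c * (j + 5)\<^sup>2)"
    using assms(2) by (intro strict_mono_onI) (simp add: power_strict_mono)
  moreover have "exp 1 > (2::real)"
    using exp_lower_Taylor_quadratic[of 1] by simp
  moreover have "exp 1 \<le> exp (s * (6 * real c))"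
    using bounds[of 0] by linarith
  ultimately show ?thesis
    unfolding Lusky_numbers_def using bounds
    by (intro conjI exI[of _ "exp 1"] exI[of _ "exp (s * (6 * real c))"]) auto
qed

theorem proposition5p9:
  fixes s :: real
  assumes "s > 0"
  shows "M_s s \<in> LC \<and>
    (\<forall>p. quotient_seq (M_s s) p = mu_s s p) \<and>
    (\<exists>C\<ge>1. \<forall>p\<ge>1. inverse C * real p powr s \<le> quotient_seq (M_s s) p \<and>
                    quotient_seq (M_s s) p \<le> C * real p powr s) \<and>
    equivalent_seq (M_s s) (Gevrey s) \<and>
    Lusky_numbers (M_s s) (\<lambda>j. nat \<lceil>1 / s\<rceil> * (j + 5)\<^sup>2) \<and>
    (s \<ge> 1 \<longrightarrow> Lusky_numbers (M_s s) (\<lambda>j. (j + 5)\<^sup>2))"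
proof (intro conjI)
  show "\<exists>C\<ge>1. \<forall>p\<ge>1. inverse C * real p powr s \<le> quotient_seq (M_s s) p \<and>
                    quotient_seq (M_s s) p \<le> C * real p powr s"
  proof (intro exI[of _ "exp s"] conjI allI impI)
    fix p :: nat
    assume p: "p \<ge> 1"
    have "inverse (exp s) * real p powr s \<le> 1 * real p powr s"
      using assms by (intro mult_right_mono) (auto simp: inverse_le_1_iff)
    also have "\<dots> \<le> mu_s s p"
      using mu_s_ge_powr[OF assms p] by simp
    finally show "inverse (exp s) * real p powr s \<le> quotient_seq (M_s s) p"
      by (simp add: quotient_seq_M_s)
    show "quotient_seq (M_s s) p \<le> exp s * real p powr s"
      using mu_s_le_powr[OF assms p] by (simp add: quotient_seq_M_s)
  qed (use assms in simp)
  have "s * (1 / s) \<le> s * real (nat \<lceil>1 / s\<rceil>)"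
    using assms by (intro mult_left_mono real_nat_ceiling_ge) simp
  then have "s * real (nat \<lceil>1 / s\<rceil>) \<ge> 1"
    using assms by (simp del: of_nat_nat)
  moreover have "nat \<lceil>1 / s\<rceil> > 0"
    using assms by simp
  ultimately show "Lusky_numbers (M_s s) (\<lambda>j. nat \<lceil>1 / s\<rceil> * (j + 5)\<^sup>2)"
    using assms by (intro Lusky_numbers_quadratic)
  show "s \<ge> 1 \<longrightarrow> Lusky_numbers (M_s s) (\<lambda>j. (j + 5)\<^sup>2)"
    using Lusky_numbers_quadratic[OF assms, of 1] by simp
qed (use assms M_s_in_LC equivalent_M_s_Gevrey quotient_seq_M_s in auto)

end
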